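(* The full subcategory $\mathbf{CPMet}\subset\mathbf{CMet}$ of complete path metric spaces contains the monoidal unit of $\mathbf{CMet}$ and is closed under tensor products, so it is a full monoidal subcategory of $\mathbf{CMet}$.
   Context: Metric spaces are allowed infinite distances: a metric takes values in $[0,\infty]$. $\mathbf{CMet}$ is the category of complete metric spaces with non-expansive (1-Lipschitz) maps as morphisms. It is symmetric monoidal: the tensor product $(X,d_X)\otimes(Y,d_Y)$ is the Cartesian product $X\times Y$ with the $\ell^1$ metric $d_{X\otimes Y}((x,y),(x',y'))=d_X(x,x')+d_Y(y,y')$, and the unit is the one-point space. The length of a continuous curve $f:[a,b]\to (X,d)$ is $\ell(f)=\sup\sum_i d(f(t_i),f(t_{i+1}))$ over all finite subdivisions $a=t_0\le t_1\le\cdots\le t_n=b$. The path metric attached to $d$ is $d_\ell(x,y)=\inf \ell(f)$ over all continuous curves $f:[a,b]\to X$ with $f(a)=x$, $f(b)=y$ (with $\inf\emptyset=\infty$). $(X,d)$ is a path metric space if $d=d_\ell$. *)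

theory Defs
  imports "HOL-Analysis.Analysis"
begin

section \<open>Metric spaces with values in $[0,\infty]$\<close>

text \<open>The distance function is only meaningful on \<open>pts X\<close>; its values elsewhere are arbitrary.
  The empty space is allowed.\<close>

record 'a emetric =
  pts :: "'a set"
  dst :: "'a \<Rightarrow> 'a \<Rightarrow> ennreal"

definition emetric_space :: "'a emetric \<Rightarrow> bool" where
  "emetric_space X \<longleftrightarrow>
     (\<forall>x\<in>pts X. \<forall>y\<in>pts X. dst X x y = 0 \<longleftrightarrow> x = y) \<and>
     (\<forall>x\<in>pts X. \<forall>y\<in>pts X. dst X x y = dst X y x) \<and>
     (\<forall>x\<in>pts X. \<forall>y\<in>pts X. \<forall>z\<in>pts X. dst X x z \<le> dst X x y + dst X y z)"

definition eopen :: "'a emetric \<Rightarrow> 'a set \<Rightarrow> bool" where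
  "eopen X U \<longleftrightarrow> U \<subseteq> pts X \<and>
     (\<forall>x\<in>U. \<exists>r>0. \<forall>y\<in>pts X. dst X x y < r \<longrightarrow> y \<in> U)"

definition etopology :: "'a emetric \<Rightarrow> 'a topology" where
  "etopology X = topology (eopen X)"

lemma istopology_eopen: "istopology (eopen X)"
  unfolding istopology_def
proof (intro conjI allI impI)
  fix S T assume S: "eopen X S" and T: "eopen X T"
  show "eopen X (S \<inter> T)"
    unfolding eopen_def
  proof (intro conjI ballI)
    show "S \<inter> T \<subseteq> pts X" using S by (auto simp: eopen_def)
    fix x assume x: "x \<in> S \<inter> T"
    obtain r where r: "r > 0" "\<forall>y\<in>pts X. dst X x y < r \<longrightarrow> y \<in> S"
      using S x by (auto simp: eopen_def)
    obtain s where s: "s > 0" "\<forall>y\<in>pts X. dst X x y < s \<longrightarrow> y \<in> T"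
      using T x by (auto simp: eopen_def)
    show "\<exists>r>0. \<forall>y\<in>pts X. dst X x y < r \<longrightarrow> y \<in> S \<inter> T"
      using r s by (intro exI[of _ "min r s"]) auto
  qed
next
  fix K assume "\<forall>S\<in>K. eopen X S"
  then show "eopen X (\<Union>K)"
    unfolding eopen_def by (meson Sup_least UnionE UnionI)
qed

lemma openin_etopology: "openin (etopology X) = eopen X"
  unfolding etopology_def by (rule topology_inverse'[OF istopology_eopen])

definition ecauchy :: "'a emetric \<Rightarrow> (nat \<Rightarrow> 'a) \<Rightarrow> bool" where
  "ecauchy X s \<longleftrightarrow> range s \<subseteq> pts X \<and>
     (\<forall>r>0. \<exists>N. \<forall>m\<ge>N. \<forall>n\<ge>N. dst X (s m) (s n) < r)"

definition complete_emetric_space :: "'a emetric \<Rightarrow> bool" where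
  "complete_emetric_space X \<longleftrightarrow> emetric_space X \<and>
     (\<forall>s. ecauchy X s \<longrightarrow> (\<exists>l. limitin (etopology X) s l sequentially))"

section \<open>Path metrics\<close>

definition curve :: "'a emetric \<Rightarrow> real \<Rightarrow> real \<Rightarrow> (real \<Rightarrow> 'a) \<Rightarrow> bool" where
  "curve X a b f \<longleftrightarrow> a \<le> b \<and> continuous_map (top_of_set {a..b}) (etopology X) f"

definition curve_length :: "'a emetric \<Rightarrow> real \<Rightarrow> real \<Rightarrow> (real \<Rightarrow> 'a) \<Rightarrow> ennreal" where
  "curve_length X a b f =
     Sup {(\<Sum>i<n. dst X (f (t i)) (f (t (Suc i)))) | (n::nat) (t::nat \<Rightarrow> real).
            t 0 = a \<and> t n = b \<and> (\<forall>i<n. t i \<le> t (Suc i))}"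

definition path_dist :: "'a emetric \<Rightarrow> 'a \<Rightarrow> 'a \<Rightarrow> ennreal" where
  "path_dist X x y = Inf {curve_length X a b f | a b f. curve X a b f \<and> f a = x \<and> f b = y}"

definition path_metric_space :: "'a emetric \<Rightarrow> bool" where
  "path_metric_space X \<longleftrightarrow> emetric_space X \<and>
     (\<forall>x\<in>pts X. \<forall>y\<in>pts X. dst X x y = path_dist X x y)"

definition complete_path_metric_space :: "'a emetric \<Rightarrow> bool" where
  "complete_path_metric_space X \<longleftrightarrow> complete_emetric_space X \<and> path_metric_space X"

section \<open>Tensor product and unit\<close>

definition tensor_space :: "'a emetric \<Rightarrow> 'b emetric \<Rightarrow> ('a \<times> 'b) emetric" where
  "tensor_space X Y =
     \<lparr>pts = pts X \<times> pts Y,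
      dst = (\<lambda>u v. dst X (fst u) (fst v) + dst Y (snd u) (snd v))\<rparr>"

definition unit_space :: "unit emetric" where
  "unit_space = \<lparr>pts = {()}, dst = (\<lambda>_ _. 0)\<rparr>"

section \<open>Monoidal categories\<close>

text \<open>Categories are given by hom-sets indexed by objects, which need not be disjoint.
  \<open>Cmp C X Y Z g f\<close> is the composite of \<open>f : X \<rightarrow> Y\<close> followed by \<open>g : Y \<rightarrow> Z\<close>.
  \<open>TenM C X X' Y Y' f g\<close> is the tensor product of \<open>f : X \<rightarrow> X'\<close> and \<open>g : Y \<rightarrow> Y'\<close>.
  All operations are only meaningful on the objects and morphisms of the category.\<close>

record ('o, 'm) cat =
  Obj :: "'o set"
  Hom :: "'o \<Rightarrow> 'o \<Rightarrow> 'm set"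
  Idn :: "'o \<Rightarrow> 'm"
  Cmp :: "'o \<Rightarrow> 'o \<Rightarrow> 'o \<Rightarrow> 'm \<Rightarrow> 'm \<Rightarrow> 'm"

record ('o, 'm) moncat = "('o, 'm) cat" +
  Unt :: "'o"
  Ten :: "'o \<Rightarrow> 'o \<Rightarrow> 'o"
  TenM :: "'o \<Rightarrow> 'o \<Rightarrow> 'o \<Rightarrow> 'o \<Rightarrow> 'm \<Rightarrow> 'm \<Rightarrow> 'm"
  Asc :: "'o \<Rightarrow> 'o \<Rightarrow> 'o \<Rightarrow> 'm"
  Lun :: "'o \<Rightarrow> 'm"
  Run :: "'o \<Rightarrow> 'm"

locale category =
  fixes C :: "('o, 'm, 'z) cat_scheme"
  assumes Idn_in: "X \<in> Obj C \<Longrightarrow> Idn C X \<in> Hom C X X"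
    and Cmp_in: "\<lbrakk>X \<in> Obj C; Y \<in> Obj C; Z \<in> Obj C; f \<in> Hom C X Y; g \<in> Hom C Y Z\<rbrakk>
          \<Longrightarrow> Cmp C X Y Z g f \<in> Hom C X Z"
    and Cmp_Idn_left: "\<lbrakk>X \<in> Obj C; Y \<in> Obj C; f \<in> Hom C X Y\<rbrakk>
          \<Longrightarrow> Cmp C X Y Y (Idn C Y) f = f"
    and Cmp_Idn_right: "\<lbrakk>X \<in> Obj C; Y \<in> Obj C; f \<in> Hom C X Y\<rbrakk>
          \<Longrightarrow> Cmp C X X Y f (Idn C X) = f"
    and Cmp_assoc: "\<lbrakk>W \<in> Obj C; X \<in> Obj C; Y \<in> Obj C; Z \<in> Obj C;
            f \<in> Hom C W X; g \<in> Hom C X Y; h \<in> Hom C Y Z\<rbrakk>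
          \<Longrightarrow> Cmp C W X Z (Cmp C X Y Z h g) f = Cmp C W Y Z h (Cmp C W X Y g f)"

definition isom :: "('o, 'm, 'z) cat_scheme \<Rightarrow> 'o \<Rightarrow> 'o \<Rightarrow> 'm \<Rightarrow> bool" where
  "isom C X Y f \<longleftrightarrow> f \<in> Hom C X Y \<and>
     (\<exists>g\<in>Hom C Y X. Cmp C X Y X g f = Idn C X \<and> Cmp C Y X Y f g = Idn C Y)"

locale monoidal_category = category C
  for C :: "('o, 'm, 'z) moncat_scheme" +
  assumes Unt_in: "Unt C \<in> Obj C"
    and Ten_in: "\<lbrakk>X \<in> Obj C; Y \<in> Obj C\<rbrakk> \<Longrightarrow> Ten C X Y \<in> Obj C"
    and TenM_in: "\<lbrakk>X \<in> Obj C; X' \<in> Obj C; Y \<in> Obj C; Y' \<in> Obj C; f \<in> Hom C X X'; g \<in> Hom C Y Y'\<rbrakk>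
          \<Longrightarrow> TenM C X X' Y Y' f g \<in> Hom C (Ten C X Y) (Ten C X' Y')"
    and TenM_Idn: "\<lbrakk>X \<in> Obj C; Y \<in> Obj C\<rbrakk>
          \<Longrightarrow> TenM C X X Y Y (Idn C X) (Idn C Y) = Idn C (Ten C X Y)"
    and TenM_Cmp: "\<lbrakk>X \<in> Obj C; X' \<in> Obj C; X'' \<in> Obj C; Y \<in> Obj C; Y' \<in> Obj C; Y'' \<in> Obj C;
            f \<in> Hom C X X'; f' \<in> Hom C X' X''; g \<in> Hom C Y Y'; g' \<in> Hom C Y' Y''\<rbrakk>
          \<Longrightarrow> TenM C X X'' Y Y'' (Cmp C X X' X'' f' f) (Cmp C Y Y' Y'' g' g)
            = Cmp C (Ten C X Y) (Ten C X' Y') (Ten C X'' Y'')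
                (TenM C X' X'' Y' Y'' f' g') (TenM C X X' Y Y' f g)"
    and Asc_isom: "\<lbrakk>X \<in> Obj C; Y \<in> Obj C; Z \<in> Obj C\<rbrakk>
          \<Longrightarrow> isom C (Ten C (Ten C X Y) Z) (Ten C X (Ten C Y Z)) (Asc C X Y Z)"
    and Asc_natural: "\<lbrakk>X \<in> Obj C; X' \<in> Obj C; Y \<in> Obj C; Y' \<in> Obj C; Z \<in> Obj C; Z' \<in> Obj C;
            f \<in> Hom C X X'; g \<in> Hom C Y Y'; h \<in> Hom C Z Z'\<rbrakk>
          \<Longrightarrow> Cmp C (Ten C (Ten C X Y) Z) (Ten C (Ten C X' Y') Z') (Ten C X' (Ten C Y' Z'))
                (Asc C X' Y' Z')
                (TenM C (Ten C X Y) (Ten C X' Y') Z Z' (TenM C X X' Y Y' f g) h)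
            = Cmp C (Ten C (Ten C X Y) Z) (Ten C X (Ten C Y Z)) (Ten C X' (Ten C Y' Z'))
                (TenM C X X' (Ten C Y Z) (Ten C Y' Z') f (TenM C Y Y' Z Z' g h))
                (Asc C X Y Z)"
    and Lun_isom: "X \<in> Obj C \<Longrightarrow> isom C (Ten C (Unt C) X) X (Lun C X)"
    and Lun_natural: "\<lbrakk>X \<in> Obj C; X' \<in> Obj C; f \<in> Hom C X X'\<rbrakk>
          \<Longrightarrow> Cmp C (Ten C (Unt C) X) (Ten C (Unt C) X') X' (Lun C X')
                (TenM C (Unt C) (Unt C) X X' (Idn C (Unt C)) f)
            = Cmp C (Ten C (Unt C) X) X X' f (Lun C X)"
    and Run_isom: "X \<in> Obj C \<Longrightarrow> isom C (Ten C X (Unt C)) X (Run C X)"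
    and Run_natural: "\<lbrakk>X \<in> Obj C; X' \<in> Obj C; f \<in> Hom C X X'\<rbrakk>
          \<Longrightarrow> Cmp C (Ten C X (Unt C)) (Ten C X' (Unt C)) X' (Run C X')
                (TenM C X X' (Unt C) (Unt C) f (Idn C (Unt C)))
            = Cmp C (Ten C X (Unt C)) X X' f (Run C X)"
    and triangle: "\<lbrakk>X \<in> Obj C; Y \<in> Obj C\<rbrakk>
          \<Longrightarrow> Cmp C (Ten C (Ten C X (Unt C)) Y) (Ten C X (Ten C (Unt C) Y)) (Ten C X Y)
                (TenM C X X (Ten C (Unt C) Y) Y (Idn C X) (Lun C Y)) (Asc C X (Unt C) Y)
            = TenM C (Ten C X (Unt C)) X Y Y (Run C X) (Idn C Y)"
    and pentagon: "\<lbrakk>W \<in> Obj C; X \<in> Obj C; Y \<in> Obj C; Z \<in> Obj C\<rbrakk>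
          \<Longrightarrow> Cmp C (Ten C (Ten C (Ten C W X) Y) Z) (Ten C (Ten C W X) (Ten C Y Z))
                (Ten C W (Ten C X (Ten C Y Z)))
                (Asc C W X (Ten C Y Z)) (Asc C (Ten C W X) Y Z)
            = Cmp C (Ten C (Ten C (Ten C W X) Y) Z) (Ten C W (Ten C (Ten C X Y) Z))
                (Ten C W (Ten C X (Ten C Y Z)))
                (TenM C W W (Ten C (Ten C X Y) Z) (Ten C X (Ten C Y Z)) (Idn C W) (Asc C X Y Z))
                (Cmp C (Ten C (Ten C (Ten C W X) Y) Z) (Ten C (Ten C W (Ten C X Y)) Z)
                  (Ten C W (Ten C (Ten C X Y) Z))
                  (Asc C W (Ten C X Y) Z)
                  (TenM C (Ten C (Ten C W X) Y) (Ten C W (Ten C X Y)) Z Z (Asc C W X Y) (Idn C Z)))"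

definition full_subcategory :: "('o, 'm, 'y) cat_scheme \<Rightarrow> ('o, 'm, 'z) cat_scheme \<Rightarrow> bool" where
  "full_subcategory D C \<longleftrightarrow> category C \<and> category D \<and> Obj D \<subseteq> Obj C \<and>
     (\<forall>X\<in>Obj D. \<forall>Y\<in>Obj D. Hom D X Y = Hom C X Y) \<and>
     (\<forall>X\<in>Obj D. Idn D X = Idn C X) \<and>
     (\<forall>X\<in>Obj D. \<forall>Y\<in>Obj D. \<forall>Z\<in>Obj D. \<forall>f\<in>Hom D X Y. \<forall>g\<in>Hom D Y Z.
        Cmp D X Y Z g f = Cmp C X Y Z g f)"

definition full_monoidal_subcategory ::
    "('o, 'm, 'y) moncat_scheme \<Rightarrow> ('o, 'm, 'z) moncat_scheme \<Rightarrow> bool" where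
  "full_monoidal_subcategory D C \<longleftrightarrow>
     full_subcategory D C \<and> monoidal_category C \<and> monoidal_category D \<and>
     Unt D = Unt C \<and>
     (\<forall>X\<in>Obj D. \<forall>Y\<in>Obj D. Ten D X Y = Ten C X Y) \<and>
     (\<forall>X\<in>Obj D. \<forall>X'\<in>Obj D. \<forall>Y\<in>Obj D. \<forall>Y'\<in>Obj D. \<forall>f\<in>Hom D X X'. \<forall>g\<in>Hom D Y Y'.
        TenM D X X' Y Y' f g = TenM C X X' Y Y' f g) \<and>
     (\<forall>X\<in>Obj D. \<forall>Y\<in>Obj D. \<forall>Z\<in>Obj D. Asc D X Y Z = Asc C X Y Z) \<and>
     (\<forall>X\<in>Obj D. Lun D X = Lun C X) \<and>
     (\<forall>X\<in>Obj D. Run D X = Run C X)"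

section \<open>The categories CMet and CPMet\<close>

text \<open>The objects of a category must share one type of points, so the categories live in a
  universe \<open>'u\<close> that is closed under pairing by means of an injection \<open>p :: 'u \<times> 'u \<Rightarrow> 'u\<close>
  (every infinite type admits one). The tensor product is the honest \<open>\<ell>\<^sup>1\<close> product, renamed along \<open>p\<close>,
  and the unit is the honest one-point space, with its point renamed to \<open>e\<close>.\<close>

definition rename :: "('a \<Rightarrow> 'b) \<Rightarrow> 'a emetric \<Rightarrow> 'b emetric" where
  "rename h X = \<lparr>pts = h ` pts X,
     dst = (\<lambda>u v. dst X (inv_into (pts X) h u) (inv_into (pts X) h v))\<rparr>"

definition utensor :: "('u \<times> 'u \<Rightarrow> 'u) \<Rightarrow> 'u emetric \<Rightarrow> 'u emetric \<Rightarrow> 'u emetric" where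
  "utensor p X Y = rename p (tensor_space X Y)"

definition uunit :: "'u \<Rightarrow> 'u emetric" where
  "uunit e = rename (\<lambda>_. e) unit_space"

definition nonexpansive :: "'a emetric \<Rightarrow> 'b emetric \<Rightarrow> ('a \<Rightarrow> 'b) set" where
  "nonexpansive X Y =
     {f \<in> pts X \<rightarrow>\<^sub>E pts Y. \<forall>x\<in>pts X. \<forall>x'\<in>pts X. dst Y (f x) (f x') \<le> dst X x x'}"

definition CMet :: "('u \<times> 'u \<Rightarrow> 'u) \<Rightarrow> 'u \<Rightarrow> ('u emetric, 'u \<Rightarrow> 'u) moncat" where
  "CMet p e =
    \<lparr>Obj = {X. complete_emetric_space X},
     Hom = nonexpansive,
     Idn = (\<lambda>X. restrict id (pts X)),
     Cmp = (\<lambda>X Y Z g f. compose (pts X) g f),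
     Unt = uunit e,
     Ten = utensor p,
     TenM = (\<lambda>X X' Y Y' f g.
       restrict (\<lambda>w. p (map_prod f g (inv p w))) (pts (utensor p X Y))),
     Asc = (\<lambda>X Y Z.
       restrict (\<lambda>w. let (u, z) = inv p w; (x, y) = inv p u in p (x, p (y, z)))
         (pts (utensor p (utensor p X Y) Z))),
     Lun = (\<lambda>X. restrict (\<lambda>w. snd (inv p w)) (pts (utensor p (uunit e) X))),
     Run = (\<lambda>X. restrict (\<lambda>w. fst (inv p w)) (pts (utensor p X (uunit e))))\<rparr>"

definition CPMet :: "('u \<times> 'u \<Rightarrow> 'u) \<Rightarrow> 'u \<Rightarrow> ('u emetric, 'u \<Rightarrow> 'u) moncat" where
  "CPMet p e = (CMet p e)\<lparr>Obj := {X. complete_path_metric_space X}\<rparr>"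

end

theory Submission
  imports Defs
begin

text \<open>
  Two points carry the substance. Completeness of \<open>X \<otimes> Y\<close>: a sequence of pairs is Cauchy for the
  \<open>\<ell>\<^sup>1\<close> metric only if both of its components are Cauchy, and the pair of their limits is
  a limit of the pairs (\<open>limitin_tensor_space\<close>, \<open>complete_emetric_space_tensor\<close>).

  That \<open>X \<otimes> Y\<close> is again a path metric space: a metric never exceeds its path metric, so it is
  enough to join \<open>(x, y)\<close> to \<open>(x', y')\<close> by curves of length close to \<open>d(x, x') + d(y, y')\<close> when this
  sum is finite. Take almost shortest curves from \<open>x\<close> to \<open>x'\<close> and from \<open>y\<close> to \<open>y'\<close>, reparametrise both over \<open>[0, 1]\<close>
  and run them simultaneously. As the \<open>\<ell>\<^sup>1\<close> metric is a sum, so is each polygonal sum of the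
  resulting curve, and its length is at most the sum of the two lengths (\<open>path_dist_tensor_le\<close>).
  In this way no curves have to be concatenated and no subdivision has to be refined at the
  point where two curves meet.

  The categorical part is formal. The tensor product and the unit of the category are the honest
  ones with their points renamed injectively, and completeness and the path metric property are
  invariant under surjective isometries. The monoidal category laws of \<open>CMet\<close> are checked on points.
  Finally, restricting a monoidal category to any class of objects that contains the unit and is
  closed under the tensor product gives a full monoidal subcategory
  (\<open>full_monoidal_subcategory_Obj_update\<close>), which is applied to the class of complete path metric
  spaces.
\<close>

section \<open>Convergence in an extended metric space\<close>

lemma emetric_spaceD:
  assumes "emetric_space X"
  shows emetric_self: "x \<in> pts X \<Longrightarrow> dst X x x = 0"
    and emetric_eq: "\<lbrakk>x \<in> pts X; y \<in> pts X; dst X x y = 0\<rbrakk> \<Longrightarrow> x = y"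
    and emetric_sym: "\<lbrakk>x \<in> pts X; y \<in> pts X\<rbrakk> \<Longrightarrow> dst X x y = dst X y x"
    and emetric_triangle: "\<lbrakk>x \<in> pts X; y \<in> pts X; z \<in> pts X\<rbrakk> \<Longrightarrow> dst X x z \<le> dst X x y + dst X y z"
  using assms unfolding emetric_space_def by blast+

lemma topspace_etopology: "topspace (etopology X) = pts X"
proof -
  have "eopen X (pts X)"
    unfolding eopen_def using zero_less_one by blast
  then show ?thesis
    unfolding topspace_def openin_etopology by (auto simp only: eopen_def)
qed

lemma eopen_ball:
  assumes X: "emetric_space X" and x: "x \<in> pts X"
  shows "eopen X {y \<in> pts X. dst X x y < r}"
  unfolding eopen_def
proof (intro conjI ballI)
  fix y assume "y \<in> {y \<in> pts X. dst X x y < r}"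
  then have y: "y \<in> pts X" "dst X x y < r" by auto
  have "z \<in> {y \<in> pts X. dst X x y < r}" if "z \<in> pts X" "dst X y z < r - dst X x y" for z
  proof -
    have "dst X x z \<le> dst X x y + dst X y z"
      using emetric_triangle[OF X] x y that by blast
    also have "\<dots> < r"
      using that y by (metis ennreal_minus_le_iff linorder_not_less order_less_imp_not_eq2 top.not_eq_extremum)
    finally show ?thesis using that by simp
  qed
  moreover have "r - dst X x y > 0"
    using y by (simp add: diff_gr0_ennreal less_top)
  ultimately show "\<exists>s>0. \<forall>z\<in>pts X. dst X y z < s \<longrightarrow> z \<in> {y \<in> pts X. dst X x y < r}"
    by blast
qed auto

text \<open>The filter is arbitrary, so that this covers both limits of sequences, as needed for
  completeness, and limits at the points of an interval, as needed for continuity of curves.\<close>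

lemma limitin_etopology:
  assumes X: "emetric_space X"
  shows "limitin (etopology X) f l F \<longleftrightarrow>
    l \<in> pts X \<and> (\<forall>r>0. \<forall>\<^sub>F n in F. f n \<in> pts X \<and> dst X l (f n) < r)"
    (is "?L \<longleftrightarrow> ?R")
proof
  assume L: ?L
  then have l: "l \<in> pts X" by (simp add: limitin_def topspace_etopology)
  show ?R
  proof (intro conjI allI impI l)
    fix r :: ennreal assume "r > 0"
    then have "l \<in> {y \<in> pts X. dst X l y < r}" using l emetric_self[OF X] by simp
    then have "\<forall>\<^sub>F n in F. f n \<in> {y \<in> pts X. dst X l y < r}"
      using L eopen_ball[OF X l, of r] unfolding limitin_def openin_etopology by blast
    then show "\<forall>\<^sub>F n in F. f n \<in> pts X \<and> dst X l (f n) < r" by simp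
  qed
next
  assume R: ?R
  have "\<forall>\<^sub>F n in F. f n \<in> U" if U: "eopen X U" "l \<in> U" for U
  proof -
    obtain r where r: "r > 0" "\<forall>y\<in>pts X. dst X l y < r \<longrightarrow> y \<in> U"
      using U unfolding eopen_def by blast
    then have "\<forall>\<^sub>F n in F. f n \<in> pts X \<and> dst X l (f n) < r" using R by blast
    then show ?thesis by eventually_elim (use r in blast)
  qed
  then show ?L using R by (simp add: limitin_def topspace_etopology openin_etopology)
qed

lemma nonexpansiveD:
  assumes "f \<in> nonexpansive X Y"
  shows nonexpansive_pts: "x \<in> pts X \<Longrightarrow> f x \<in> pts Y"
    and nonexpansive_le: "\<lbrakk>x \<in> pts X; x' \<in> pts X\<rbrakk> \<Longrightarrow> dst Y (f x) (f x') \<le> dst X x x'"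
    and nonexpansive_extensional: "f \<in> extensional (pts X)"
  using assms by (auto simp: nonexpansive_def PiE_def)

lemma limitin_nonexpansive:
  assumes "emetric_space X" "emetric_space Y" "h \<in> nonexpansive X Y"
    and "limitin (etopology X) f l F"
  shows "limitin (etopology Y) (\<lambda>n. h (f n)) (h l) F"
proof -
  have l: "l \<in> pts X" and ev: "\<And>r. r > 0 \<Longrightarrow> \<forall>\<^sub>F n in F. f n \<in> pts X \<and> dst X l (f n) < r"
    using assms(4) by (auto simp: limitin_etopology[OF assms(1)])
  have "\<forall>\<^sub>F n in F. h (f n) \<in> pts Y \<and> dst Y (h l) (h (f n)) < r" if "r > 0" for r
    using ev[OF that]
  proof eventually_elim
    case (elim n)
    then have "dst Y (h l) (h (f n)) \<le> dst X l (f n)"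
      using nonexpansive_le[OF assms(3) l] by blast
    then show ?case using elim nonexpansive_pts[OF assms(3)] by auto
  qed
  then show ?thesis
    using l nonexpansive_pts[OF assms(3)] by (simp add: limitin_etopology[OF assms(2)])
qed

lemma curve_nonexpansive:
  assumes "emetric_space X" "emetric_space Y" "h \<in> nonexpansive X Y" "curve X a b f"
  shows "curve Y a b (\<lambda>t. h (f t))"
  using assms(4) limitin_nonexpansive[OF assms(1-3)]
  unfolding curve_def continuous_map_atin by blast

section \<open>Length and the path metric\<close>

text \<open>A curve is only constrained on its interval, so distances along a subdivision can be
  compared only once the subdivision points are known to lie there.\<close>

lemma subdivision_in_interval:
  fixes t :: "nat \<Rightarrow> real"
  assumes "t 0 = a" "t n = b" "\<forall>i<n. t i \<le> t (Suc i)" "i \<le> n"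
  shows "t i \<in> {a..b}"
proof -
  have "t 0 \<le> t i" using assms(4)
    by (induction i rule: nat_induct) (use assms(3) in \<open>auto intro: order_trans\<close>)
  moreover have "t i \<le> t n" using assms(4)
    by (induction i rule: inc_induct) (use assms(3) in \<open>auto intro: order_trans\<close>)
  ultimately show ?thesis using assms by simp
qed

lemma subdivision_sum_le_curve_length:
  assumes "t 0 = a" "t n = b" "\<And>i. i < n \<Longrightarrow> t i \<le> t (Suc i)"
  shows "(\<Sum>i<n. dst X (f (t i)) (f (t (Suc i)))) \<le> curve_length X a b f"
  unfolding curve_length_def by (rule Sup_upper) (use assms in blast)

lemma curve_length_least:
  assumes "\<And>(n::nat) t. \<lbrakk>t 0 = a; t n = b; \<forall>i<n. t i \<le> t (Suc i)\<rbrakk>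
      \<Longrightarrow> (\<Sum>i<n. dst X (f (t i)) (f (t (Suc i)))) \<le> L"
  shows "curve_length X a b f \<le> L"
  unfolding curve_length_def by (rule Sup_least) (use assms in blast)

lemma path_dist_le: "curve X a b f \<Longrightarrow> path_dist X (f a) (f b) \<le> curve_length X a b f"
  unfolding path_dist_def by (rule Inf_lower) blast

text \<open>The two endpoints alone form a subdivision. As a consequence, only the inequality
  \<open>path_dist X x y \<le> dst X x y\<close> ever has to be shown for a path metric space.\<close>

lemma dst_le_path_dist: "dst X x y \<le> path_dist X x y"
  unfolding path_dist_def
proof (rule Inf_greatest, clarify)
  fix a b f assume "curve X a b f"
  then have "a \<le> b" by (simp add: curve_def)
  then show "dst X (f a) (f b) \<le> curve_length X a b f"
    using subdivision_sum_le_curve_length[of "\<lambda>i. if i = 0 then a else b" a 1 b X f] by simp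
qed

lemma path_metric_spaceI:
  assumes "emetric_space X"
    and "\<And>x y. \<lbrakk>x \<in> pts X; y \<in> pts X\<rbrakk> \<Longrightarrow> path_dist X x y \<le> dst X x y"
  shows "path_metric_space X"
  using assms unfolding path_metric_space_def by (auto intro: antisym dst_le_path_dist)

text \<open>A non-expansive map sends a curve to a curve and shrinks every term of its polygonal sums.\<close>

lemma path_dist_nonexpansive:
  assumes X: "emetric_space X" and Y: "emetric_space Y" and h: "h \<in> nonexpansive X Y"
  shows "path_dist Y (h x) (h y) \<le> path_dist X x y"
  unfolding path_dist_def[of X]
proof (rule Inf_greatest, clarify)
  fix a b f assume f: "curve X a b f"
  have f_pts: "f t \<in> pts X" if "t \<in> {a..b}" for t
    using f that by (auto simp: curve_def continuous_map_def topspace_etopology)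
  have "path_dist Y (h (f a)) (h (f b)) \<le> curve_length Y a b (\<lambda>t. h (f t))"
    using path_dist_le[OF curve_nonexpansive[OF X Y h f]] .
  also have "\<dots> \<le> curve_length X a b f"
  proof (rule curve_length_least)
    fix n :: nat and t assume t: "t 0 = a" "t n = b" "\<forall>i<n. t i \<le> t (Suc i)"
    have "(\<Sum>i<n. dst Y (h (f (t i))) (h (f (t (Suc i))))) \<le> (\<Sum>i<n. dst X (f (t i)) (f (t (Suc i))))"
      using subdivision_in_interval[OF t] by (intro sum_mono nonexpansive_le[OF h] f_pts) auto
    also have "\<dots> \<le> curve_length X a b f"
      by (rule subdivision_sum_le_curve_length) (use t in auto)
    finally show "(\<Sum>i<n. dst Y (h (f (t i))) (h (f (t (Suc i))))) \<le> curve_length X a b f" .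
  qed
  finally show "path_dist Y (h (f a)) (h (f b)) \<le> curve_length X a b f" .
qed

text \<open>The affine map from \<open>[0, 1]\<close> onto \<open>[a, b]\<close> sends a subdivision to a subdivision with the
  same polygonal sum; it is constant if \<open>a = b\<close>, in which case it still preserves endpoints.\<close>

lemma curve_on_unit_interval:
  assumes "curve X a b f"
  obtains g where "curve X 0 1 g" "g 0 = f a" "g 1 = f b" "curve_length X 0 1 g \<le> curve_length X a b f"
proof -
  define \<phi> where "\<phi> s = a + s * (b - a)" for s :: real
  have ab: "a \<le> b" using assms by (simp add: curve_def)
  then have mono: "s \<le> t \<Longrightarrow> \<phi> s \<le> \<phi> t" for s t
    by (simp add: \<phi>_def mult_right_mono)
  have ends: "\<phi> 0 = a" "\<phi> 1 = b" by (simp_all add: \<phi>_def)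
  have "continuous_map (top_of_set {0..1}) (top_of_set {a..b}) \<phi>"
    unfolding continuous_map_subtopology_eu
  proof
    show "continuous_on {0..1} \<phi>" unfolding \<phi>_def by (intro continuous_intros)
    show "\<phi> \<in> {0..1} \<rightarrow> {a..b}" using mono[of 0] mono[of _ 1] ends by auto
  qed
  then have "curve X 0 1 (f \<circ> \<phi>)"
    using assms unfolding curve_def by (intro conjI continuous_map_compose[of _ _ \<phi>]) auto
  moreover have "curve_length X 0 1 (f \<circ> \<phi>) \<le> curve_length X a b f"
  proof (rule curve_length_least)
    fix n :: nat and t :: "nat \<Rightarrow> real" assume t: "t 0 = 0" "t n = 1" "\<forall>i<n. t i \<le> t (Suc i)"
    show "(\<Sum>i<n. dst X ((f \<circ> \<phi>) (t i)) ((f \<circ> \<phi>) (t (Suc i)))) \<le> curve_length X a b f"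
      using subdivision_sum_le_curve_length[of "\<lambda>i. \<phi> (t i)" a n b X f] t ends mono by simp
  qed
  ultimately show ?thesis using that[of "f \<circ> \<phi>"] ends by simp
qed

section \<open>Invariance under surjective isometries\<close>

lemma emetric_space_isometry:
  assumes X: "emetric_space X" and surj: "h ` pts X = pts Y"
    and iso: "\<And>x y. \<lbrakk>x \<in> pts X; y \<in> pts X\<rbrakk> \<Longrightarrow> dst Y (h x) (h y) = dst X x y"
  shows "emetric_space Y"
  unfolding emetric_space_def surj[symmetric] ball_simps
proof (intro conjI ballI)
  fix x y assume xy: "x \<in> pts X" "y \<in> pts X"
  show "dst Y (h x) (h y) = dst Y (h y) (h x)"
    using xy emetric_sym[OF X] by (simp add: iso)
  show "dst Y (h x) (h y) = 0 \<longleftrightarrow> h x = h y"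
  proof
    assume "dst Y (h x) (h y) = 0"
    then show "h x = h y" using xy emetric_eq[OF X, of x y] by (simp add: iso)
  next
    assume "h x = h y"
    then have "dst Y (h x) (h y) = dst Y (h x) (h x)" by simp
    then show "dst Y (h x) (h y) = 0" using xy emetric_self[OF X] by (simp add: iso)
  qed
  fix z assume "z \<in> pts X"
  then show "dst Y (h x) (h z) \<le> dst Y (h x) (h y) + dst Y (h y) (h z)"
    using xy emetric_triangle[OF X] by (simp add: iso)
qed

lemma isometry_nonexpansive:
  assumes "h ` pts X = pts Y"
    and "\<And>x y. \<lbrakk>x \<in> pts X; y \<in> pts X\<rbrakk> \<Longrightarrow> dst Y (h x) (h y) = dst X x y"
  shows "restrict h (pts X) \<in> nonexpansive X Y"
  using assms by (auto simp: nonexpansive_def)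

lemma ecauchy_mono:
  assumes s: "ecauchy X s" and u: "\<And>n. u n \<in> pts Y"
    and le: "\<And>m n. dst Y (u m) (u n) \<le> dst X (s m) (s n)"
  shows "ecauchy Y u"
  unfolding ecauchy_def
proof (intro conjI allI impI)
  show "range u \<subseteq> pts Y" using u by blast
  fix r :: ennreal assume "r > 0"
  then obtain N where "\<And>m n. \<lbrakk>m \<ge> N; n \<ge> N\<rbrakk> \<Longrightarrow> dst X (s m) (s n) < r"
    using s unfolding ecauchy_def by meson
  then show "\<exists>N. \<forall>m\<ge>N. \<forall>n\<ge>N. dst Y (u m) (u n) < r"
    using order_le_less_trans[OF le] by meson
qed

text \<open>A Cauchy sequence is lifted through the surjection; its lift is Cauchy because distances are
  preserved, and the limit of the lift is mapped to a limit.\<close>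

lemma complete_emetric_space_isometry:
  assumes X: "complete_emetric_space X" and surj: "h ` pts X = pts Y"
    and iso: "\<And>x y. \<lbrakk>x \<in> pts X; y \<in> pts X\<rbrakk> \<Longrightarrow> dst Y (h x) (h y) = dst X x y"
  shows "complete_emetric_space Y"
  unfolding complete_emetric_space_def
proof (intro conjI allI impI)
  have mX: "emetric_space X" using X by (simp add: complete_emetric_space_def)
  show mY: "emetric_space Y" using emetric_space_isometry[OF mX surj iso] .
  fix s assume s: "ecauchy Y s"
  then have "s n \<in> h ` pts X" for n
    by (auto simp: ecauchy_def surj)
  then have "\<forall>n. \<exists>x. x \<in> pts X \<and> h x = s n"
    by (metis imageE)
  then obtain u where u: "\<And>n. u n \<in> pts X" "\<And>n. h (u n) = s n" by metis
  have "dst Y (s m) (s n) = dst X (u m) (u n)" for m n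
    using iso[OF u(1) u(1), of m n] by (simp add: u(2))
  then have "ecauchy X u"
    by (intro ecauchy_mono[OF s] u) simp
  then obtain l where "limitin (etopology X) u l sequentially"
    using X unfolding complete_emetric_space_def by blast
  from limitin_nonexpansive[OF mX mY isometry_nonexpansive[OF surj iso] this]
  show "\<exists>l. limitin (etopology Y) s l sequentially"
    by (auto simp: u)
qed

lemma path_metric_space_isometry:
  assumes X: "path_metric_space X" and surj: "h ` pts X = pts Y"
    and iso: "\<And>x y. \<lbrakk>x \<in> pts X; y \<in> pts X\<rbrakk> \<Longrightarrow> dst Y (h x) (h y) = dst X x y"
  shows "path_metric_space Y"
proof (rule path_metric_spaceI)
  have mX: "emetric_space X" using X by (simp add: path_metric_space_def)
  show mY: "emetric_space Y" using emetric_space_isometry[OF mX surj iso] .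
  fix x y assume "x \<in> pts Y" "y \<in> pts Y"
  then obtain u v where uv: "u \<in> pts X" "v \<in> pts X" "x = h u" "y = h v"
    unfolding surj[symmetric] by blast
  show "path_dist Y x y \<le> dst Y x y"
    using path_dist_nonexpansive[OF mX mY isometry_nonexpansive[OF surj iso], of u v] uv X
    by (simp add: iso path_metric_space_def)
qed

lemma complete_path_metric_space_isometry:
  assumes X: "complete_path_metric_space X" and surj: "h ` pts X = pts Y"
    and iso: "\<And>x y. \<lbrakk>x \<in> pts X; y \<in> pts X\<rbrakk> \<Longrightarrow> dst Y (h x) (h y) = dst X x y"
  shows "complete_path_metric_space Y"
  using X complete_emetric_space_isometry[OF _ surj iso] path_metric_space_isometry[OF _ surj iso]
  by (simp add: complete_path_metric_space_def)

lemma pts_rename: "pts (rename h X) = h ` pts X"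
  by (simp add: rename_def)

lemma dst_rename:
  assumes "inj_on h (pts X)" "x \<in> pts X" "y \<in> pts X"
  shows "dst (rename h X) (h x) (h y) = dst X x y"
  using assms by (simp add: rename_def)

lemma complete_emetric_space_rename:
  "\<lbrakk>complete_emetric_space X; inj_on h (pts X)\<rbrakk> \<Longrightarrow> complete_emetric_space (rename h X)"
  by (rule complete_emetric_space_isometry[where h = h, OF _ pts_rename[symmetric] dst_rename])

lemma complete_path_metric_space_rename:
  "\<lbrakk>complete_path_metric_space X; inj_on h (pts X)\<rbrakk> \<Longrightarrow> complete_path_metric_space (rename h X)"
  by (rule complete_path_metric_space_isometry[where h = h, OF _ pts_rename[symmetric] dst_rename])

section \<open>The one-point space\<close>

lemma complete_path_metric_space_unit: "complete_path_metric_space unit_space"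
proof -
  have m: "emetric_space unit_space"
    by (simp add: emetric_space_def unit_space_def)
  have "limitin (etopology unit_space) s () sequentially" for s
    unfolding limitin_etopology[OF m] by (simp add: unit_space_def)
  then have "complete_emetric_space unit_space"
    using m unfolding complete_emetric_space_def by blast
  moreover have "path_metric_space unit_space"
  proof (rule path_metric_spaceI[OF m])
    fix x y :: unit
    have "curve unit_space 0 0 (\<lambda>_. ())"
      by (simp add: curve_def topspace_etopology unit_space_def)
    from path_dist_le[OF this] have "path_dist unit_space x y \<le> curve_length unit_space 0 0 (\<lambda>_. ())"
      by simp
    also have "\<dots> \<le> 0"
      by (rule curve_length_least) (simp add: unit_space_def)
    finally show "path_dist unit_space x y \<le> dst unit_space x y" by simp
  qed
  ultimately show ?thesis by (simp add: complete_path_metric_space_def)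
qed

section \<open>The tensor product\<close>

lemma tensor_space_simps [simp]:
  "pts (tensor_space X Y) = pts X \<times> pts Y"
  "dst (tensor_space X Y) (x, y) (x', y') = dst X x x' + dst Y y y'"
  by (simp_all add: tensor_space_def)

lemma emetric_space_tensor:
  assumes X: "emetric_space X" and Y: "emetric_space Y"
  shows "emetric_space (tensor_space X Y)"
  unfolding emetric_space_def
proof (intro conjI ballI; clarsimp)
  fix x y x' y' assume a: "x \<in> pts X" "y \<in> pts Y" "x' \<in> pts X" "y' \<in> pts Y"
  show "dst X x x' = 0 \<and> dst Y y y' = 0 \<longleftrightarrow> x = x' \<and> y = y'"
    using a emetric_self[OF X] emetric_self[OF Y] emetric_eq[OF X] emetric_eq[OF Y] by blast
  show "dst X x x' + dst Y y y' = dst X x' x + dst Y y' y"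
    using a by (simp only: emetric_sym[OF X, of x x'] emetric_sym[OF Y, of y y'])
  fix x'' y'' assume b: "x'' \<in> pts X" "y'' \<in> pts Y"
  have "dst X x x'' + dst Y y y'' \<le> (dst X x x' + dst X x' x'') + (dst Y y y' + dst Y y' y'')"
    using a b by (intro add_mono emetric_triangle[OF X] emetric_triangle[OF Y])
  then show "dst X x x'' + dst Y y y'' \<le> dst X x x' + dst Y y y' + (dst X x' x'' + dst Y y' y'')"
    by (simp add: ac_simps)
qed

text \<open>Each component contributes less than \<open>r / 2\<close>, which is positive and halves \<open>r\<close> also for
  \<open>r = \<infinity>\<close>.\<close>

lemma limitin_tensor_space:
  assumes X: "emetric_space X" and Y: "emetric_space Y"
    and f: "limitin (etopology X) f l F" and g: "limitin (etopology Y) g m F"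
  shows "limitin (etopology (tensor_space X Y)) (\<lambda>t. (f t, g t)) (l, m) F"
  unfolding limitin_etopology[OF emetric_space_tensor[OF X Y]]
proof (intro conjI allI impI)
  show "(l, m) \<in> pts (tensor_space X Y)"
    using f g by (simp add: limitin_etopology X Y)
  fix r :: ennreal assume "r > 0"
  then have "r / 2 > 0" by (simp add: ennreal_zero_less_divide)
  then have "\<forall>\<^sub>F t in F. f t \<in> pts X \<and> dst X l (f t) < r / 2"
    and "\<forall>\<^sub>F t in F. g t \<in> pts Y \<and> dst Y m (g t) < r / 2"
    using f g X Y by (auto simp: limitin_etopology)
  then show "\<forall>\<^sub>F t in F. (f t, g t) \<in> pts (tensor_space X Y) \<and> dst (tensor_space X Y) (l, m) (f t, g t) < r"
  proof eventually_elim
    case (elim t)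
    have "dst X l (f t) + dst Y m (g t) < r / 2 + r / 2"
      using elim by (intro add_strict_mono) auto
    also have "\<dots> = r"
      using mult_divide_eq_ennreal[of 2 r] by (simp add: mult_2_right add_divide_distrib_ennreal)
    finally show ?case using elim by simp
  qed
qed

lemma complete_emetric_space_tensor:
  assumes X: "complete_emetric_space X" and Y: "complete_emetric_space Y"
  shows "complete_emetric_space (tensor_space X Y)"
  unfolding complete_emetric_space_def
proof (intro conjI allI impI)
  have mX: "emetric_space X" and mY: "emetric_space Y"
    using X Y by (auto simp: complete_emetric_space_def)
  show "emetric_space (tensor_space X Y)" using emetric_space_tensor[OF mX mY] .
  fix s assume s: "ecauchy (tensor_space X Y) s"
  have dst_s: "dst (tensor_space X Y) (s m) (s n)
      = dst X (fst (s m)) (fst (s n)) + dst Y (snd (s m)) (snd (s n))" for m n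
    by (simp add: tensor_space_def)
  have "s n \<in> pts X \<times> pts Y" for n
    using s unfolding ecauchy_def tensor_space_simps by blast
  then have "fst (s n) \<in> pts X" "snd (s n) \<in> pts Y" for n
    by (simp_all add: mem_Times_iff)
  then have "ecauchy X (\<lambda>n. fst (s n))" "ecauchy Y (\<lambda>n. snd (s n))"
    by (auto intro!: ecauchy_mono[OF s] simp: dst_s)
  then obtain l m where "limitin (etopology X) (\<lambda>n. fst (s n)) l sequentially"
    "limitin (etopology Y) (\<lambda>n. snd (s n)) m sequentially"
    using X Y unfolding complete_emetric_space_def by blast
  from limitin_tensor_space[OF mX mY this]
  show "\<exists>l. limitin (etopology (tensor_space X Y)) s l sequentially" by auto
qed

text \<open>A curve in \<open>X\<close> and a curve in \<open>Y\<close>, both reparametrised over \<open>[0, 1]\<close>, are traversed at the same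
  time; any common subdivision splits the polygonal sum of the pair into a sum for each of them.\<close>

lemma path_dist_tensor_le:
  assumes X: "emetric_space X" and Y: "emetric_space Y"
  shows "path_dist (tensor_space X Y) (x, y) (x', y') \<le> path_dist X x x' + path_dist Y y y'"
proof -
  let ?D = "path_dist (tensor_space X Y) (x, y) (x', y')"
  have *: "?D \<le> curve_length X a b f + curve_length Y c d g"
    if f: "curve X a b f" "f a = x" "f b = x'" and g: "curve Y c d g" "g c = y" "g d = y'"
    for a b f c d g
  proof -
    obtain f' where f': "curve X 0 1 f'" "f' 0 = x" "f' 1 = x'"
      "curve_length X 0 1 f' \<le> curve_length X a b f"
      using curve_on_unit_interval[OF f(1)] f by metis
    obtain g' where g': "curve Y 0 1 g'" "g' 0 = y" "g' 1 = y'"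
      "curve_length Y 0 1 g' \<le> curve_length Y c d g"
      using curve_on_unit_interval[OF g(1)] g by metis
    let ?h = "\<lambda>t. (f' t, g' t)"
    have "curve (tensor_space X Y) 0 1 ?h"
      using f'(1) g'(1) limitin_tensor_space[OF X Y]
      unfolding curve_def continuous_map_atin by blast
    from path_dist_le[OF this] have "?D \<le> curve_length (tensor_space X Y) 0 1 ?h"
      using f' g' by simp
    also have "\<dots> \<le> curve_length X 0 1 f' + curve_length Y 0 1 g'"
    proof (rule curve_length_least)
      fix n :: nat and t :: "nat \<Rightarrow> real" assume t: "t 0 = 0" "t n = 1" "\<forall>i<n. t i \<le> t (Suc i)"
      then show "(\<Sum>i<n. dst (tensor_space X Y) (?h (t i)) (?h (t (Suc i))))
          \<le> curve_length X 0 1 f' + curve_length Y 0 1 g'"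
        by (auto simp: sum.distrib intro!: add_mono subdivision_sum_le_curve_length)
    qed
    also have "\<dots> \<le> curve_length X a b f + curve_length Y c d g"
      using f' g' by (intro add_mono)
    finally show ?thesis .
  qed
  (* Addition of a constant commutes with infima in [0, \<infinity>], also with the infimum of the empty set,
     which occurs when the two points are not joined by any curve. *)
  have le_add_Inf: "A \<le> k + Inf T" if "\<And>t. t \<in> T \<Longrightarrow> A \<le> k + t" for A k :: ennreal and T
  proof (cases "k = top")
    case False
    then have "A - k \<le> Inf T"
      using that by (intro Inf_greatest) (simp add: ennreal_minus_le_iff)
    then show ?thesis by (simp add: ennreal_minus_le_iff)
  qed simp
  have "?D \<le> curve_length X a b f + path_dist Y y y'"
    if f: "curve X a b f" "f a = x" "f b = x'" for a b f
    unfolding path_dist_def[of Y] by (rule le_add_Inf) (use *[OF f] in blast)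
  then have "?D \<le> path_dist Y y y' + path_dist X x x'"
    unfolding path_dist_def[of X] by (intro le_add_Inf) (auto simp: add.commute)
  then show ?thesis by (simp add: add.commute)
qed

lemma complete_path_metric_space_tensor:
  assumes "complete_path_metric_space X" "complete_path_metric_space Y"
  shows "complete_path_metric_space (tensor_space X Y)"
proof -
  have X: "emetric_space X" "\<And>x x'. \<lbrakk>x \<in> pts X; x' \<in> pts X\<rbrakk> \<Longrightarrow> path_dist X x x' = dst X x x'"
    and Y: "emetric_space Y" "\<And>y y'. \<lbrakk>y \<in> pts Y; y' \<in> pts Y\<rbrakk> \<Longrightarrow> path_dist Y y y' = dst Y y y'"
    using assms by (simp_all add: complete_path_metric_space_def path_metric_space_def)
  have "path_metric_space (tensor_space X Y)"
  proof (rule path_metric_spaceI[OF emetric_space_tensor[OF X(1) Y(1)]])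
    fix u v assume "u \<in> pts (tensor_space X Y)" "v \<in> pts (tensor_space X Y)"
    then show "path_dist (tensor_space X Y) u v \<le> dst (tensor_space X Y) u v"
      using path_dist_tensor_le[OF X(1) Y(1), of "fst u" "snd u" "fst v" "snd v"]
      by (auto simp: X(2) Y(2))
  qed
  then show ?thesis
    using assms complete_emetric_space_tensor[of X Y] by (simp add: complete_path_metric_space_def)
qed

section \<open>The monoidal category of complete metric spaces\<close>

lemma nonexpansiveI:
  assumes "f \<in> extensional (pts X)" "\<And>x. x \<in> pts X \<Longrightarrow> f x \<in> pts Y"
    and "\<And>x x'. \<lbrakk>x \<in> pts X; x' \<in> pts X\<rbrakk> \<Longrightarrow> dst Y (f x) (f x') \<le> dst X x x'"
  shows "f \<in> nonexpansive X Y"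
  unfolding nonexpansive_def using assms by (simp add: PiE_def Pi_def)

lemma nonexpansive_compose:
  assumes f: "f \<in> nonexpansive X Y" and g: "g \<in> nonexpansive Y Z"
  shows "compose (pts X) g f \<in> nonexpansive X Z"
proof (rule nonexpansiveI)
  note pts = nonexpansive_pts[OF f] nonexpansive_pts[OF g]
  show "compose (pts X) g f \<in> extensional (pts X)" by (simp add: compose_def)
  show "compose (pts X) g f x \<in> pts Z" if "x \<in> pts X" for x
    using that by (simp add: compose_eq pts)
  fix x x' assume x: "x \<in> pts X" "x' \<in> pts X"
  have "dst Z (g (f x)) (g (f x')) \<le> dst Y (f x) (f x')"
    using x by (intro nonexpansive_le[OF g] pts)
  also have "\<dots> \<le> dst X x x'"
    using x by (intro nonexpansive_le[OF f])
  finally show "dst Z (compose (pts X) g f x) (compose (pts X) g f x') \<le> dst X x x'"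
    using x by (simp add: compose_eq)
qed

lemma uunit_simps [simp]: "pts (uunit e) = {e}" "dst (uunit e) x y = 0"
  by (simp_all add: uunit_def rename_def unit_space_def)

lemma complete_path_metric_space_uunit: "complete_path_metric_space (uunit e)"
  unfolding uunit_def
  by (rule complete_path_metric_space_rename[OF complete_path_metric_space_unit])
    (simp add: inj_on_def)

lemma complete_emetric_space_uunit: "complete_emetric_space (uunit e)"
  using complete_path_metric_space_uunit[of e] by (simp add: complete_path_metric_space_def)

lemma CMet_simps [simp]:
  "Obj (CMet p e) = {X. complete_emetric_space X}"
  "Hom (CMet p e) = nonexpansive"
  "Unt (CMet p e) = uunit e"
  "Ten (CMet p e) = utensor p"
  by (simp_all add: CMet_def)

text \<open>The inverse of a surjective isometry is again an isometry. All structure isomorphisms of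
  \<open>CMet\<close> are instances of this, so their inverses need not be written down.\<close>

lemma isom_CMet:
  assumes X: "emetric_space X" and f: "f \<in> extensional (pts X)" and surj: "f ` pts X = pts Y"
    and iso: "\<And>x y. \<lbrakk>x \<in> pts X; y \<in> pts X\<rbrakk> \<Longrightarrow> dst Y (f x) (f y) = dst X x y"
  shows "isom (CMet p e) X Y f"
proof -
  have inj: "inj_on f (pts X)"
  proof (rule inj_onI)
    fix x y assume xy: "x \<in> pts X" "y \<in> pts X" "f x = f y"
    then have "dst X x y = dst X x x" using iso[of x y] iso[of x x] by simp
    then show "x = y" using xy emetric_self[OF X] emetric_eq[OF X] by simp
  qed
  let ?g = "restrict (inv_into (pts X) f) (pts Y)"
  have g: "f (?g y) = y" "?g y \<in> pts X" if "y \<in> pts Y" for y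
    using that by (auto simp: f_inv_into_f inv_into_into simp flip: surj)
  have "f \<in> nonexpansive X Y"
    using f surj iso by (intro nonexpansiveI) auto
  moreover have "?g \<in> nonexpansive Y X"
    by (rule nonexpansiveI) (use g iso in \<open>simp_all flip: iso\<close>)
  moreover have "compose (pts X) ?g f = restrict id (pts X)"
    using inj by (auto simp: compose_def fun_eq_iff simp flip: surj)
  moreover have "compose (pts Y) f ?g = restrict id (pts Y)"
    using g by (auto simp: compose_def fun_eq_iff)
  ultimately show ?thesis
    by (auto simp: isom_def CMet_def intro!: bexI[of _ ?g])
qed

lemma category_CMet: "category (CMet p e)"
proof
  show "Idn (CMet p e) X \<in> Hom (CMet p e) X X" for X :: "'a emetric"
    by (auto simp: CMet_def nonexpansive_def)
  show "Cmp (CMet p e) X Y Z g f \<in> Hom (CMet p e) X Z"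
    if "f \<in> Hom (CMet p e) X Y" "g \<in> Hom (CMet p e) Y Z" for X Y Z :: "'a emetric" and f g
    using nonexpansive_compose[of f X Y g Z] that by (simp add: CMet_def)
  show "Cmp (CMet p e) X Y Y (Idn (CMet p e) Y) f = f"
    "Cmp (CMet p e) X X Y f (Idn (CMet p e) X) = f"
    if "f \<in> Hom (CMet p e) X Y" for X Y :: "'a emetric" and f
  proof -
    have f: "f \<in> nonexpansive X Y" using that by simp
    show "Cmp (CMet p e) X Y Y (Idn (CMet p e) Y) f = f"
      by (rule extensionalityI[OF _ nonexpansive_extensional[OF f]])
        (simp_all add: CMet_def compose_eq nonexpansive_pts[OF f])
    show "Cmp (CMet p e) X X Y f (Idn (CMet p e) X) = f"
      by (rule extensionalityI[OF _ nonexpansive_extensional[OF f]])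
        (simp_all add: CMet_def compose_eq)
  qed
  show "Cmp (CMet p e) W X Z (Cmp (CMet p e) X Y Z h g) f
      = Cmp (CMet p e) W Y Z h (Cmp (CMet p e) W X Y g f)"
    if "f \<in> Hom (CMet p e) W X" for W X Y Z :: "'a emetric" and f g h
    using nonexpansive_pts[of f W X] that
    by (simp add: CMet_def compose_def restrict_def fun_eq_iff)
qed

context
  fixes p :: "'u \<times> 'u \<Rightarrow> 'u"
  assumes p: "inj p"
begin

lemma pts_utensor: "pts (utensor p X Y) = p ` (pts X \<times> pts Y)"
  by (simp add: utensor_def pts_rename)

lemma dst_utensor:
  assumes "x \<in> pts X" "x' \<in> pts X" "y \<in> pts Y" "y' \<in> pts Y"
  shows "dst (utensor p X Y) (p (x, y)) (p (x', y')) = dst X x x' + dst Y y y'"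
  unfolding utensor_def using assms inj_on_subset[OF p] dst_rename[of p "tensor_space X Y" "(x, y)" "(x', y')"] by simp

lemma pair_in_utensor: "p (x, y) \<in> pts (utensor p X Y) \<longleftrightarrow> x \<in> pts X \<and> y \<in> pts Y"
  by (simp add: pts_utensor inj_image_mem_iff[OF p])

lemma complete_emetric_space_utensor:
  "\<lbrakk>complete_emetric_space X; complete_emetric_space Y\<rbrakk> \<Longrightarrow> complete_emetric_space (utensor p X Y)"
  unfolding utensor_def
  by (intro complete_emetric_space_rename complete_emetric_space_tensor inj_on_subset[OF p]) auto

lemma complete_path_metric_space_utensor:
  "\<lbrakk>complete_path_metric_space X; complete_path_metric_space Y\<rbrakk>
    \<Longrightarrow> complete_path_metric_space (utensor p X Y)"
  unfolding utensor_def
  by (intro complete_path_metric_space_rename complete_path_metric_space_tensor inj_on_subset[OF p]) auto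

text \<open>Together with extensionality, the values of the structure maps at pairs reduce every equation
  of morphisms to a computation with pairs.\<close>

lemma CMet_apply:
  "x \<in> pts X \<Longrightarrow> Idn (CMet p e) X x = x"
  "x \<in> pts X \<Longrightarrow> Cmp (CMet p e) X Y Z g f x = g (f x)"
  "\<lbrakk>x \<in> pts X; y \<in> pts Y\<rbrakk> \<Longrightarrow> TenM (CMet p e) X X' Y Y' f g (p (x, y)) = p (f x, g y)"
  "\<lbrakk>x \<in> pts X; y \<in> pts Y; z \<in> pts Z\<rbrakk> \<Longrightarrow> Asc (CMet p e) X Y Z (p (p (x, y), z)) = p (x, p (y, z))"
  "x \<in> pts X \<Longrightarrow> Lun (CMet p e) X (p (e, x)) = x"
  "x \<in> pts X \<Longrightarrow> Run (CMet p e) X (p (x, e)) = x"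
  by (simp_all add: CMet_def compose_eq pair_in_utensor inv_f_f[OF p])

lemmas utensor_simps = pts_utensor inj_image_mem_iff[OF p] CMet_apply dst_utensor

lemma CMet_extensional:
  "Idn (CMet p e) X \<in> extensional (pts X)"
  "Cmp (CMet p e) X Y Z g f \<in> extensional (pts X)"
  "TenM (CMet p e) X X' Y Y' f g \<in> extensional (pts (utensor p X Y))"
  "Asc (CMet p e) X Y Z \<in> extensional (pts (utensor p (utensor p X Y) Z))"
  "Lun (CMet p e) X \<in> extensional (pts (utensor p (uunit e) X))"
  "Run (CMet p e) X \<in> extensional (pts (utensor p X (uunit e)))"
  by (simp_all add: CMet_def)

lemma TenM_nonexpansive:
  assumes "f \<in> nonexpansive X X'" "g \<in> nonexpansive Y Y'"
  shows "TenM (CMet p e) X X' Y Y' f g \<in> nonexpansive (utensor p X Y) (utensor p X' Y')"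
  using assms
  by (intro nonexpansiveI CMet_extensional)
    (auto simp: pts_utensor CMet_apply dst_utensor nonexpansive_pts nonexpansive_le intro!: add_mono)

lemma Asc_isom:
  assumes X: "complete_emetric_space X" and Y: "complete_emetric_space Y"
    and Z: "complete_emetric_space Z"
  shows "isom (CMet p e) (utensor p (utensor p X Y) Z) (utensor p X (utensor p Y Z)) (Asc (CMet p e) X Y Z)"
  using complete_emetric_space_utensor[OF complete_emetric_space_utensor[OF X Y] Z]
  unfolding complete_emetric_space_def
  by (intro isom_CMet CMet_extensional)
    (* The domain is a metric space; rebracketing is surjective; addition is associative. *)
    (blast, force simp: utensor_simps image_iff, auto simp: utensor_simps add.assoc)

lemma Lun_isom:
  assumes X: "complete_emetric_space X"
  shows "isom (CMet p e) (utensor p (uunit e) X) X (Lun (CMet p e) X)"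
  using complete_emetric_space_utensor[OF complete_emetric_space_uunit X]
  unfolding complete_emetric_space_def
  by (intro isom_CMet CMet_extensional)
    (blast, force simp: utensor_simps image_iff, auto simp: utensor_simps)

lemma Run_isom:
  assumes X: "complete_emetric_space X"
  shows "isom (CMet p e) (utensor p X (uunit e)) X (Run (CMet p e) X)"
  using complete_emetric_space_utensor[OF X complete_emetric_space_uunit]
  unfolding complete_emetric_space_def
  by (intro isom_CMet CMet_extensional)
    (blast, force simp: utensor_simps image_iff, auto simp: utensor_simps)

text \<open>The structure maps only rebracket points or drop the point \<open>e\<close>, so that every coherence
  and naturality law holds on points; two maps that are undefined off the same space and agree on
  its points are equal.\<close>

lemma monoidal_category_CMet: "monoidal_category (CMet p e)"
proof (intro monoidal_category.intro monoidal_category_axioms.intro category_CMet;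
    simp only: CMet_simps mem_Collect_eq)
  show "complete_emetric_space (uunit e)"
    by (rule complete_emetric_space_uunit)
qed (simp_all only: complete_emetric_space_utensor TenM_nonexpansive Asc_isom Lun_isom Run_isom,
    (* What is left are the equations, in which both sides are extensional on the same domain. *)
    (rule extensionalityI, rule CMet_extensional, rule CMet_extensional,
     auto simp: pts_utensor CMet_apply nonexpansive_pts)+)

end

section \<open>Full monoidal subcategories\<close>

text \<open>Every law of a monoidal category is universally quantified over objects, and being an
  isomorphism refers to morphisms only; hence all laws survive the restriction to \<open>S\<close> once
  the unit and the tensor products stay in \<open>S\<close>.\<close>

lemma full_monoidal_subcategory_Obj_update:
  fixes C :: "('o, 'm, 'z) moncat_scheme"
  assumes C: "monoidal_category C" and S: "S \<subseteq> Obj C" "Unt C \<in> S"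
    and Ten: "\<And>X Y. \<lbrakk>X \<in> S; Y \<in> S\<rbrakk> \<Longrightarrow> Ten C X Y \<in> S"
  shows "full_monoidal_subcategory (C\<lparr>Obj := S\<rparr>) C"
proof -
  interpret C: monoidal_category C by (rule C)
  have [simp]: "isom (C\<lparr>Obj := S\<rparr>) X Y f = isom C X Y f" for X Y f
    by (simp add: isom_def)
  note SC = subsetD[OF S(1)]
  have "monoidal_category (C\<lparr>Obj := S\<rparr>)"
    by unfold_locales
      (simp_all add: SC S Ten C.Idn_in C.Cmp_in C.Cmp_Idn_left C.Cmp_Idn_right C.Cmp_assoc
        C.TenM_in C.TenM_Idn C.TenM_Cmp C.Asc_isom C.Asc_natural C.Lun_isom C.Lun_natural
        C.Run_isom C.Run_natural C.triangle C.pentagon)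
  then show ?thesis
    using C S(1) unfolding full_monoidal_subcategory_def full_subcategory_def monoidal_category_def
    by simp
qed

theorem lemma3p2:
  fixes p :: "'u \<times> 'u \<Rightarrow> 'u" and e :: 'u
  assumes "inj p"
  shows "complete_path_metric_space unit_space
    \<and> (\<forall>(X :: 'a emetric) (Y :: 'b emetric).
         complete_path_metric_space X \<and> complete_path_metric_space Y
           \<longrightarrow> complete_path_metric_space (tensor_space X Y))
    \<and> full_monoidal_subcategory (CPMet p e) (CMet p e)"
proof (intro conjI allI impI)
  show "full_monoidal_subcategory (CPMet p e) (CMet p e)"
    unfolding CPMet_def
  proof (rule full_monoidal_subcategory_Obj_update[OF monoidal_category_CMet[OF assms]])
    show "{X. complete_path_metric_space X} \<subseteq> Obj (CMet p e)"
      by (auto simp: complete_path_metric_space_def)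
    show "Unt (CMet p e) \<in> {X. complete_path_metric_space X}"
      by (simp add: complete_path_metric_space_uunit)
    fix X Y :: "'u emetric"
    assume "X \<in> {X. complete_path_metric_space X}" "Y \<in> {X. complete_path_metric_space X}"
    then show "Ten (CMet p e) X Y \<in> {X. complete_path_metric_space X}"
      using complete_path_metric_space_utensor[OF assms] by simp
  qed
qed (use complete_path_metric_space_unit complete_path_metric_space_tensor in blast)+

end
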